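(* Let $(M,P,g)$ be a $\mathcal{W}_1$-manifold with $\dim M=2n$, let $\nabla$ be the Levi-Civita connection of $g$ with curvature tensor $R$, and let $\nabla'$ be the natural connection on $(M,P,g)$ determined by the pair of real parameters $(\lambda,\mu)$, with curvature tensor $R'$. Then $$R=R'-g(p,p)\pi_1-g(q,q)\pi_2-g(p,q)\pi_3-\psi_1(S')-\psi_2(S'').$$
   Context: Setting. A Riemannian almost product manifold $(M,P,g)$ is a differentiable manifold $M$ with a $(1,1)$-tensor field $P$ and a Riemannian metric $g$ such that $P^2x=x$ and $g(Px,Py)=g(x,y)$. Throughout $\operatorname{tr}P=0$ and $\dim M=2n$; $x,y,z,w$ are arbitrary smooth vector fields (or tangent vectors). The associated metric is $\widetilde g(x,y)=g(x,Py)$. Let $\nabla$ be the Levi-Civita connection of $g$, $F(x,y,z)=g((\nabla_xP)y,z)$, and $\theta(x)=g^{ij}F(e_i,e_j,x)$, where $\{e_i\}$ is a basis of the tangent space and $(g^{ij})$ is the inverse matrix of $(g(e_i,e_j))$. $(M,P,g)$ is a $\mathcal{W}_1$-manifold if $$F(x,y,z)=\tfrac{1}{2n}\{g(x,y)\theta(z)-g(x,Py)\theta(Pz)+g(x,z)\theta(y)-g(x,Pz)\theta(Py)\}.$$ The vector field $\Omega$ is defined by $g(\Omega,x)=\theta(x)$. Natural connections. A linear connection $\nabla'$ is natural if $\nabla'P=\nabla'g=0$. The natural connections considered on a $\mathcal{W}_1$-manifold form a 2-parametric family with parameters $\lambda,\mu\in\mathbb{R}$; the one determined by $(\lambda,\mu)$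 is $$\nabla'_xy=\nabla_xy+g(x,Py)\{\lambda P\Omega+\mu\Omega\}-\{\lambda\theta(Py)+\mu\theta(y)\}Px+g(x,y)\{\lambda\Omega+(\mu+\tfrac1{2n})P\Omega\}-\{\lambda\theta(y)+(\mu+\tfrac1{2n})\theta(Py)\}x.$$ Curvature. $R(x,y)z=\nabla_x\nabla_yz-\nabla_y\nabla_xz-\nabla_{[x,y]}z$, $R(x,y,z,w)=g(R(x,y)z,w)$, and analogously $R'$ for $\nabla'$. Notation. For a $(0,2)$-tensor $S$: $\psi_1(S)(x,y,z,w)=g(y,z)S(x,w)-g(x,z)S(y,w)+S(y,z)g(x,w)-S(x,z)g(y,w)$ and $\psi_2(S)(x,y,z,w)=\psi_1(S)(x,y,Pz,Pw)$. Put $\pi_1=\frac12\psi_1(g)$, $\pi_2=\frac12\psi_2(g)$, $\pi_3=\psi_1(\widetilde g)$. Further, $p=\lambda\Omega+(\mu+\frac1{2n})P\Omega$, $q=\lambda P\Omega+\mu\Omega$, $U(x,w)=\lambda(\nabla'_x\theta)w+(\mu+\frac1{2n})(\nabla'_x\theta)Pw$, $V(x,w)=\lambda(\nabla'_x\theta)Pw+\mu(\nabla'_x\theta)w$, $$S'(y,z)=U(y,z)-\tfrac1{2n}\{\lambda\theta(y)\theta(Pz)+\mu\theta(y)\theta(z)\},$$ $$S''(y,z)=V(y,Pz)+\tfrac1{2n}\{\lambda\theta(Py)\theta(z)+\mu\theta(Py)\theta(Pz)\}.$$ *)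

theory Defs
  imports "HOL-Analysis.Analysis" "HOL-Library.Function_Algebras"
begin

text \<open>
  The manifold is the whole type \<open>'a\<close>; it is modelled on \<open>real ^ 'm\<close>, so its dimension is
  \<open>CARD('m)\<close>. Real functions, tangent vectors and vector fields are added and subtracted, and
  real functions multiplied, pointwise (theory Function_Algebras).
\<close>

section \<open>Smooth manifolds\<close>

text \<open>Only used for open \<open>S\<close>.\<close>

primrec Ck_on :: "nat \<Rightarrow> 'x::real_normed_vector set \<Rightarrow> ('x \<Rightarrow> 'y::real_normed_vector) \<Rightarrow> bool" where
  "Ck_on 0 S f \<longleftrightarrow> continuous_on S f"
| "Ck_on (Suc k) S f \<longleftrightarrow>
     (\<forall>x\<in>S. f differentiable (at x)) \<and> (\<forall>v. Ck_on k S (\<lambda>x. frechet_derivative f (at x) v))"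

definition smooth_on :: "'x::real_normed_vector set \<Rightarrow> ('x \<Rightarrow> 'y::real_normed_vector) \<Rightarrow> bool" where
  "smooth_on S f \<longleftrightarrow> (\<forall>k. Ck_on k S f)"

type_synonym ('a, 'm) chart = "'a set \<times> ('a \<Rightarrow> real ^ 'm)"
type_synonym ('a, 'm) atlas = "('a, 'm) chart set"

definition smooth_atlas :: "('a::topological_space, 'm::finite) atlas \<Rightarrow> bool" where
  "smooth_atlas A \<longleftrightarrow>
     (\<forall>(U, \<phi>)\<in>A. open U \<and> open (\<phi> ` U) \<and> inj_on \<phi> U \<and>
        homeomorphism U (\<phi> ` U) \<phi> (the_inv_into U \<phi>)) \<and>
     (\<Union>(U, \<phi>)\<in>A. U) = UNIV \<and>
     (\<forall>(U, \<phi>)\<in>A. \<forall>(V, \<psi>)\<in>A. smooth_on (\<phi> ` (U \<inter> V)) (\<psi> \<circ> the_inv_into U \<phi>))"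

definition smooth_functions :: "('a::topological_space, 'm::finite) atlas \<Rightarrow> ('a \<Rightarrow> real) set" where
  "smooth_functions A = {f. \<forall>(U, \<phi>)\<in>A. smooth_on (\<phi> ` U) (f \<circ> the_inv_into U \<phi>)}"

section \<open>Tangent vectors and vector fields\<close>

type_synonym 'a tvec = "('a \<Rightarrow> real) \<Rightarrow> real"
type_synonym 'a vfield = "'a \<Rightarrow> 'a tvec"

definition tscale :: "real \<Rightarrow> 'a tvec \<Rightarrow> 'a tvec" where
  "tscale c v = (\<lambda>f. c * v f)"

interpretation tv: vector_space "tscale :: real \<Rightarrow> 'a tvec \<Rightarrow> 'a tvec"
  by unfold_locales (auto simp: tscale_def fun_eq_iff algebra_simps)

text \<open>
  Tangent vectors at \<open>a\<close> are the derivations at \<open>a\<close> of the algebra of smooth functions. The last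
  condition fixes the irrelevant values on non-smooth functions, so that equality of tangent
  vectors is equality of HOL functions.
\<close>

definition tangent_space :: "('a::topological_space, 'm::finite) atlas \<Rightarrow> 'a \<Rightarrow> 'a tvec set" where
  "tangent_space A a = {v.
     (\<forall>f\<in>smooth_functions A. \<forall>h\<in>smooth_functions A. v (f + h) = v f + v h) \<and>
     (\<forall>c. \<forall>f\<in>smooth_functions A. v (\<lambda>b. c * f b) = c * v f) \<and>
     (\<forall>f\<in>smooth_functions A. \<forall>h\<in>smooth_functions A. v (f * h) = v f * h a + f a * v h) \<and>
     (\<forall>f. f \<notin> smooth_functions A \<longrightarrow> v f = 0)}"

definition deriv_along :: "'a vfield \<Rightarrow> ('a \<Rightarrow> real) \<Rightarrow> 'a \<Rightarrow> real" where
  "deriv_along X f = (\<lambda>a. X a f)"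

definition vector_fields :: "('a::topological_space, 'm::finite) atlas \<Rightarrow> 'a vfield set" where
  "vector_fields A = {X. (\<forall>a. X a \<in> tangent_space A a) \<and>
     (\<forall>f\<in>smooth_functions A. deriv_along X f \<in> smooth_functions A)}"

definition fmul :: "('a \<Rightarrow> real) \<Rightarrow> 'a vfield \<Rightarrow> 'a vfield" (infixr "\<odot>" 75) where
  "f \<odot> X = (\<lambda>a. tscale (f a) (X a))"

definition cmul :: "real \<Rightarrow> 'a vfield \<Rightarrow> 'a vfield" (infixr "\<odot>\<^sub>R" 75) where
  "c \<odot>\<^sub>R X = (\<lambda>a. tscale c (X a))"

definition lie_bracket :: "'a vfield \<Rightarrow> 'a vfield \<Rightarrow> 'a vfield" where
  "lie_bracket X Y = (\<lambda>a f. X a (deriv_along Y f) - Y a (deriv_along X f))"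

definition tangent_basis ::
  "('a::topological_space, 'm::finite) atlas \<Rightarrow> 'a \<Rightarrow> ('m \<Rightarrow> 'a tvec) \<Rightarrow> bool" where
  "tangent_basis A a e \<longleftrightarrow>
     inj e \<and> tv.independent (range e) \<and> tv.span (range e) = tangent_space A a"

section \<open>Riemannian almost product structures\<close>

type_synonym 'a metric_field = "'a \<Rightarrow> 'a tvec \<Rightarrow> 'a tvec \<Rightarrow> real"
type_synonym 'a endo_field = "'a \<Rightarrow> 'a tvec \<Rightarrow> 'a tvec"

definition met :: "'a metric_field \<Rightarrow> 'a vfield \<Rightarrow> 'a vfield \<Rightarrow> 'a \<Rightarrow> real" where
  "met g X Y = (\<lambda>a. g a (X a) (Y a))"

definition app :: "'a endo_field \<Rightarrow> 'a vfield \<Rightarrow> 'a vfield" where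
  "app P X = (\<lambda>a. P a (X a))"

definition riemannian_metric ::
  "('a::topological_space, 'm::finite) atlas \<Rightarrow> 'a metric_field \<Rightarrow> bool" where
  "riemannian_metric A g \<longleftrightarrow>
     (\<forall>a. \<forall>u\<in>tangent_space A a. \<forall>v\<in>tangent_space A a. \<forall>w\<in>tangent_space A a. \<forall>c.
        g a (u + v) w = g a u w + g a v w \<and>
        g a (tscale c u) w = c * g a u w \<and>
        g a u v = g a v u \<and>
        (u \<noteq> 0 \<longrightarrow> g a u u > 0)) \<and>
     (\<forall>X\<in>vector_fields A. \<forall>Y\<in>vector_fields A. met g X Y \<in> smooth_functions A)"

definition tensor_field_11 ::
  "('a::topological_space, 'm::finite) atlas \<Rightarrow> 'a endo_field \<Rightarrow> bool" where
  "tensor_field_11 A P \<longleftrightarrow>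
     (\<forall>a. \<forall>u\<in>tangent_space A a. \<forall>v\<in>tangent_space A a. \<forall>c.
        P a u \<in> tangent_space A a \<and>
        P a (u + v) = P a u + P a v \<and>
        P a (tscale c u) = tscale c (P a u)) \<and>
     (\<forall>X\<in>vector_fields A. app P X \<in> vector_fields A)"

text \<open>\<open>B\<close> is the matrix of \<open>P a\<close> with respect to the basis \<open>e\<close>.\<close>

definition traceless ::
  "('a::topological_space, 'm::finite) atlas \<Rightarrow> 'a endo_field \<Rightarrow> bool" where
  "traceless A P \<longleftrightarrow>
     (\<forall>a e (B :: real ^ 'm ^ 'm). tangent_basis A a e \<and>
        (\<forall>j. P a (e j) = (\<Sum>i\<in>UNIV. tscale (B $ i $ j) (e i))) \<longrightarrow> trace B = 0)"

definition riemannian_almost_product ::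
  "('a::topological_space, 'm::finite) atlas \<Rightarrow> 'a metric_field \<Rightarrow> 'a endo_field \<Rightarrow> bool" where
  "riemannian_almost_product A g P \<longleftrightarrow>
     smooth_atlas A \<and> riemannian_metric A g \<and> tensor_field_11 A P \<and>
     (\<forall>a. \<forall>u\<in>tangent_space A a. \<forall>v\<in>tangent_space A a.
        P a (P a u) = u \<and> g a (P a u) (P a v) = g a u v) \<and>
     traceless A P"

definition assoc_metric ::
  "'a metric_field \<Rightarrow> 'a endo_field \<Rightarrow> 'a vfield \<Rightarrow> 'a vfield \<Rightarrow> 'a \<Rightarrow> real" where
  "assoc_metric g P X Y = met g X (app P Y)"

section \<open>Connections and curvature\<close>

type_synonym 'a conn = "'a vfield \<Rightarrow> 'a vfield \<Rightarrow> 'a vfield"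

definition linear_connection ::
  "('a::topological_space, 'm::finite) atlas \<Rightarrow> 'a conn \<Rightarrow> bool" where
  "linear_connection A D \<longleftrightarrow>
     (\<forall>X\<in>vector_fields A. \<forall>Y\<in>vector_fields A. \<forall>Z\<in>vector_fields A. \<forall>f\<in>smooth_functions A.
        D X Y \<in> vector_fields A \<and>
        D (X + Y) Z = D X Z + D Y Z \<and>
        D (f \<odot> X) Y = f \<odot> D X Y \<and>
        D X (Y + Z) = D X Y + D X Z \<and>
        D X (f \<odot> Y) = deriv_along X f \<odot> Y + f \<odot> D X Y)"

definition levi_civita ::
  "('a::topological_space, 'm::finite) atlas \<Rightarrow> 'a metric_field \<Rightarrow> 'a conn \<Rightarrow> bool" where
  "levi_civita A g D \<longleftrightarrow> linear_connection A D \<and>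
     (\<forall>X\<in>vector_fields A. \<forall>Y\<in>vector_fields A. \<forall>Z\<in>vector_fields A.
        D X Y - D Y X = lie_bracket X Y \<and>
        deriv_along X (met g Y Z) = met g (D X Y) Z + met g Y (D X Z))"

definition curv :: "'a conn \<Rightarrow> 'a vfield \<Rightarrow> 'a vfield \<Rightarrow> 'a vfield \<Rightarrow> 'a vfield" where
  "curv D X Y Z = D X (D Y Z) - D Y (D X Z) - D (lie_bracket X Y) Z"

definition curv4 ::
  "'a metric_field \<Rightarrow> 'a conn \<Rightarrow> 'a vfield \<Rightarrow> 'a vfield \<Rightarrow> 'a vfield \<Rightarrow> 'a vfield \<Rightarrow> 'a \<Rightarrow> real" where
  "curv4 g D X Y Z W = met g (curv D X Y Z) W"

definition cov_form ::
  "'a conn \<Rightarrow> ('a vfield \<Rightarrow> 'a \<Rightarrow> real) \<Rightarrow> 'a vfield \<Rightarrow> 'a vfield \<Rightarrow> 'a \<Rightarrow> real" where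
  "cov_form D \<alpha> X W = deriv_along X (\<alpha> W) - \<alpha> (D X W)"

section \<open>The class of W1-manifolds\<close>

definition F_tensor ::
  "'a metric_field \<Rightarrow> 'a endo_field \<Rightarrow> 'a conn \<Rightarrow> 'a vfield \<Rightarrow> 'a vfield \<Rightarrow> 'a vfield \<Rightarrow> 'a \<Rightarrow> real" where
  "F_tensor g P D X Y Z = met g (D X (app P Y) - app P (D X Y)) Z"

text \<open>
  As \<open>F_tensor\<close> takes vector fields, the basis at \<open>a\<close> is given by global smooth vector fields
  whose values at \<open>a\<close> form a basis of the tangent space. Such fields exist at every point (cut off
  a coordinate frame), and the sum in \<open>theta\<close> does not depend on their choice because
  \<open>F_tensor\<close> is tensorial.
\<close>

definition frame_at ::
  "('a::topological_space, 'm::finite) atlas \<Rightarrow> 'a \<Rightarrow> ('m \<Rightarrow> 'a vfield) \<Rightarrow> bool" where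
  "frame_at A a E \<longleftrightarrow> (\<forall>i. E i \<in> vector_fields A) \<and> tangent_basis A a (\<lambda>i. E i a)"

definition theta ::
  "('a::topological_space, 'm::finite) atlas \<Rightarrow> 'a metric_field \<Rightarrow> 'a endo_field \<Rightarrow> 'a conn \<Rightarrow>
     'a vfield \<Rightarrow> 'a \<Rightarrow> real" where
  "theta A g P D X = (\<lambda>a.
     let E = (SOME E. frame_at A a E);
         G = (\<chi> i j. met g (E i) (E j) a) :: real ^ 'm ^ 'm
     in \<Sum>i\<in>UNIV. \<Sum>j\<in>UNIV. matrix_inv G $ i $ j * F_tensor g P D (E i) (E j) X a)"

text \<open>\<open>D\<close> is the Levi-Civita connection of \<open>g\<close>.\<close>

definition W1_manifold ::
  "('a::topological_space, 'm::finite) atlas \<Rightarrow> nat \<Rightarrow> 'a metric_field \<Rightarrow> 'a endo_field \<Rightarrow>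
     'a conn \<Rightarrow> bool" where
  "W1_manifold A n g P D \<longleftrightarrow>
     CARD('m) = 2 * n \<and> riemannian_almost_product A g P \<and> levi_civita A g D \<and>
     (\<forall>x\<in>vector_fields A. \<forall>y\<in>vector_fields A. \<forall>z\<in>vector_fields A. \<forall>a.
        F_tensor g P D x y z a = 1 / (2 * real n) *
          (met g x y a * theta A g P D z a
           - met g x (app P y) a * theta A g P D (app P z) a
           + met g x z a * theta A g P D y a
           - met g x (app P z) a * theta A g P D (app P y) a))"

section \<open>The natural connections\<close>

definition p_field :: "nat \<Rightarrow> 'a endo_field \<Rightarrow> 'a vfield \<Rightarrow> real \<Rightarrow> real \<Rightarrow> 'a vfield" where
  "p_field n P \<Omega> lam mu = lam \<odot>\<^sub>R \<Omega> + (mu + 1 / (2 * real n)) \<odot>\<^sub>R app P \<Omega>"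

definition q_field :: "'a endo_field \<Rightarrow> 'a vfield \<Rightarrow> real \<Rightarrow> real \<Rightarrow> 'a vfield" where
  "q_field P \<Omega> lam mu = lam \<odot>\<^sub>R app P \<Omega> + mu \<odot>\<^sub>R \<Omega>"

definition natural_connection ::
  "nat \<Rightarrow> 'a metric_field \<Rightarrow> 'a endo_field \<Rightarrow> 'a conn \<Rightarrow> ('a vfield \<Rightarrow> 'a \<Rightarrow> real) \<Rightarrow> 'a vfield \<Rightarrow>
     real \<Rightarrow> real \<Rightarrow> 'a conn" where
  "natural_connection n g P D \<theta> \<Omega> lam mu x y =
     D x y
     + met g x (app P y) \<odot> (lam \<odot>\<^sub>R app P \<Omega> + mu \<odot>\<^sub>R \<Omega>)
     - (\<lambda>a. lam * \<theta> (app P y) a + mu * \<theta> y a) \<odot> app P x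
     + met g x y \<odot> (lam \<odot>\<^sub>R \<Omega> + (mu + 1 / (2 * real n)) \<odot>\<^sub>R app P \<Omega>)
     - (\<lambda>a. lam * \<theta> y a + (mu + 1 / (2 * real n)) * \<theta> (app P y) a) \<odot> x"

section \<open>The tensors in the curvature formula\<close>

type_synonym 'a tensor2 = "'a vfield \<Rightarrow> 'a vfield \<Rightarrow> 'a \<Rightarrow> real"
type_synonym 'a tensor4 = "'a vfield \<Rightarrow> 'a vfield \<Rightarrow> 'a vfield \<Rightarrow> 'a vfield \<Rightarrow> 'a \<Rightarrow> real"

definition psi1 :: "'a metric_field \<Rightarrow> 'a tensor2 \<Rightarrow> 'a tensor4" where
  "psi1 g S x y z w =
     met g y z * S x w - met g x z * S y w + S y z * met g x w - S x z * met g y w"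

definition psi2 :: "'a metric_field \<Rightarrow> 'a endo_field \<Rightarrow> 'a tensor2 \<Rightarrow> 'a tensor4" where
  "psi2 g P S x y z w = psi1 g S x y (app P z) (app P w)"

definition pi1 :: "'a metric_field \<Rightarrow> 'a tensor4" where
  "pi1 g x y z w = (\<lambda>a. 1 / 2 * psi1 g (met g) x y z w a)"

definition pi2 :: "'a metric_field \<Rightarrow> 'a endo_field \<Rightarrow> 'a tensor4" where
  "pi2 g P x y z w = (\<lambda>a. 1 / 2 * psi2 g P (met g) x y z w a)"

definition pi3 :: "'a metric_field \<Rightarrow> 'a endo_field \<Rightarrow> 'a tensor4" where
  "pi3 g P = psi1 g (assoc_metric g P)"

text \<open>In the following definitions \<open>D'\<close> is the natural connection.\<close>

definition U_tensor ::
  "nat \<Rightarrow> 'a endo_field \<Rightarrow> 'a conn \<Rightarrow> ('a vfield \<Rightarrow> 'a \<Rightarrow> real) \<Rightarrow> real \<Rightarrow> real \<Rightarrow> 'a tensor2" where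
  "U_tensor n P D' \<theta> lam mu x w = (\<lambda>a.
     lam * cov_form D' \<theta> x w a + (mu + 1 / (2 * real n)) * cov_form D' \<theta> x (app P w) a)"

definition V_tensor ::
  "'a endo_field \<Rightarrow> 'a conn \<Rightarrow> ('a vfield \<Rightarrow> 'a \<Rightarrow> real) \<Rightarrow> real \<Rightarrow> real \<Rightarrow> 'a tensor2" where
  "V_tensor P D' \<theta> lam mu x w = (\<lambda>a.
     lam * cov_form D' \<theta> x (app P w) a + mu * cov_form D' \<theta> x w a)"

definition S1_tensor ::
  "nat \<Rightarrow> 'a endo_field \<Rightarrow> 'a conn \<Rightarrow> ('a vfield \<Rightarrow> 'a \<Rightarrow> real) \<Rightarrow> real \<Rightarrow> real \<Rightarrow> 'a tensor2" where
  "S1_tensor n P D' \<theta> lam mu y z = (\<lambda>a.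
     U_tensor n P D' \<theta> lam mu y z a
     - 1 / (2 * real n) * (lam * \<theta> y a * \<theta> (app P z) a + mu * \<theta> y a * \<theta> z a))"

definition S2_tensor ::
  "nat \<Rightarrow> 'a endo_field \<Rightarrow> 'a conn \<Rightarrow> ('a vfield \<Rightarrow> 'a \<Rightarrow> real) \<Rightarrow> real \<Rightarrow> real \<Rightarrow> 'a tensor2" where
  "S2_tensor n P D' \<theta> lam mu y z = (\<lambda>a.
     V_tensor P D' \<theta> lam mu y (app P z) a
     + 1 / (2 * real n) *
         (lam * \<theta> (app P y) a * \<theta> z a + mu * \<theta> (app P y) a * \<theta> (app P z) a))"

end

theory Submission
  imports Defs
begin

text \<open>
  Write \<open>c = 1 / (2 n)\<close>. With \<open>p\<close> and \<open>q\<close> as in the statement, the natural connection is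
  \<open>D' = D + Q\<close> for the tensor
  \<open>Q x y = g(x, P y) q - g(q, y) P x + g(x, y) p - g(p, y) x\<close>.
  It is metric, because \<open>Q x\<close> is skew with respect to \<open>g\<close> (lemma \<open>D'_metric\<close>), and it
  commutes with \<open>P\<close>, because \<open>P (Q x y) - Q x (P y)\<close> is the value that the W1 condition
  prescribes for \<open>(D_x P) y\<close> (lemma \<open>D'_parallel\<close>); the latter rests on the relations
  \<open>P p - q = c \<Omega>\<close> and \<open>p - P q = c P \<Omega>\<close>.

  As \<open>D\<close> is torsion free, subtracting the two curvatures gives (lemma \<open>curv4_difference\<close>)
  \<open>R(x,y)z = R'(x,y)z - (D'_x Q)(y,z) + (D'_y Q)(x,z) - Q(T(x,y),z) + Q(x,Q(y,z)) - Q(y,Q(x,z))\<close>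
  with \<open>T(x,y) = Q(x,y) - Q(y,x)\<close> the torsion of \<open>D'\<close>.

  Since \<open>g\<close> and \<open>P\<close> are parallel for \<open>D'\<close>, differentiating \<open>Q\<close> only differentiates \<open>p\<close> and
  \<open>q\<close>, and \<open>g(D'_x p, w) = U(x,w)\<close>, \<open>g(D'_x q, w) = V(x,w)\<close>. The derivative terms therefore
  contribute \<open>- \<psi>\<^sub>1(U)\<close> and \<open>- \<psi>\<^sub>2\<close> of \<open>V\<close> with \<open>P\<close> in its second argument (lemma
  \<open>met_nabla_Q\<close>). The quadratic terms are pointwise linear algebra: the scalar products among
  \<open>p\<close> and \<open>q\<close> give the \<open>\<pi>\<close> terms, and all other products either cancel or combine, by the same
  two relations, to multiples of \<open>c\<close>. These multiples are what separates \<open>S'\<close> and \<open>S''\<close> from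
  \<open>U\<close> and \<open>V\<close> (lemma \<open>Q_quadratic_terms\<close>).

  All of this is done with vector fields, paired with a further field by \<open>g\<close>, which is why the
  space of vector fields has to be closed under the operations that build \<open>D'\<close>. That reduces to
  products of smooth functions being smooth.
\<close>

section \<open>Smooth functions form an algebra\<close>

text \<open>
  Openness matters: the Frechet derivatives of functions that agree on \<open>S\<close> agree on \<open>S\<close> only
  because each point of \<open>S\<close> has a neighbourhood inside \<open>S\<close>.
\<close>

lemma Ck_on_cong:
  assumes "open S" "Ck_on k S f" "\<And>x. x \<in> S \<Longrightarrow> f x = h x"
  shows "Ck_on k S h"
  using assms(2,3)
proof (induction k arbitrary: f h)
  case 0
  then show ?case by (simp cong: continuous_on_cong)
next
  case (Suc k)
  have diff: "(h has_derivative frechet_derivative f (at x)) (at x)" if "x \<in> S" for x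
  proof (rule has_derivative_transform_within_open[OF _ assms(1) that Suc.prems(2)])
    show "(f has_derivative frechet_derivative f (at x)) (at x)"
      using Suc.prems(1) that by (auto simp flip: frechet_derivative_works)
  qed auto
  have "frechet_derivative f (at x) v = frechet_derivative h (at x) v" if "x \<in> S" for x v
    using frechet_derivative_at[OF diff[OF that]] by simp
  moreover have "Ck_on k S (\<lambda>x. frechet_derivative f (at x) v)" for v
    using Suc.prems(1) by simp
  ultimately have "Ck_on k S (\<lambda>x. frechet_derivative h (at x) v)" for v
    by (rule Suc.IH[rotated])
  with diff show ?case by (auto simp: differentiable_def)
qed

lemma Ck_on_SucD: "Ck_on (Suc k) S f \<Longrightarrow> Ck_on k S f"
proof (induction k arbitrary: f)
  case 0
  then show ?case
    by (auto intro!: continuous_at_imp_continuous_on differentiable_imp_continuous_within)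
next
  case (Suc k)
  have "Ck_on k S (\<lambda>x. frechet_derivative f (at x) v)" for v
    by (rule Suc.IH) (use Suc.prems in simp)
  with Suc.prems show ?case
    by simp
qed

lemma Ck_on_const: "Ck_on k S (\<lambda>x. c)"
  by (induction k arbitrary: c) (auto simp: frechet_derivative_const)

lemma Ck_on_add:
  assumes "open S" "Ck_on k S f" "Ck_on k S h"
  shows "Ck_on k S (\<lambda>x. f x + h x)"
  using assms(2,3)
proof (induction k arbitrary: f h)
  case 0
  then show ?case by (auto intro: continuous_intros)
next
  case (Suc k)
  have deriv: "frechet_derivative (\<lambda>x. f x + h x) (at x) v =
      frechet_derivative f (at x) v + frechet_derivative h (at x) v"
    if "x \<in> S" for x v
  proof -
    have "((\<lambda>x. f x + h x) has_derivative
        (\<lambda>v. frechet_derivative f (at x) v + frechet_derivative h (at x) v)) (at x)"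
      by (rule has_derivative_add)
         (use Suc.prems that in \<open>auto simp flip: frechet_derivative_works\<close>)
    then show ?thesis
      by (simp flip: frechet_derivative_at)
  qed
  have Ck: "Ck_on k S (\<lambda>x. frechet_derivative f (at x) v + frechet_derivative h (at x) v)" for v
    by (rule Suc.IH) (use Suc.prems in auto)
  have "Ck_on k S (\<lambda>x. frechet_derivative (\<lambda>x. f x + h x) (at x) v)" for v
    by (rule Ck_on_cong[OF \<open>open S\<close>, of k
          "\<lambda>x. frechet_derivative f (at x) v + frechet_derivative h (at x) v"])
      (use Ck in blast, rule deriv[symmetric])
  moreover have "(\<lambda>x. f x + h x) differentiable (at x)" if "x \<in> S" for x
    by (rule differentiable_add) (use Suc.prems that in simp_all)
  ultimately show ?case
    by simp
qed

text \<open>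
  The derivative of a product contains the undifferentiated factors, which are known to be of
  class \<open>Suc k\<close> while the induction hypothesis takes class \<open>k\<close>; hence the appeal to \<open>Ck_on_SucD\<close>.
\<close>

lemma Ck_on_mult:
  fixes f h :: "'x::real_normed_vector \<Rightarrow> real"
  assumes "open S" "Ck_on k S f" "Ck_on k S h"
  shows "Ck_on k S (\<lambda>x. f x * h x)"
  using assms(2,3)
proof (induction k arbitrary: f h)
  case 0
  then show ?case by (auto intro: continuous_intros)
next
  case (Suc k)
  have deriv: "frechet_derivative (\<lambda>x. f x * h x) (at x) v =
      f x * frechet_derivative h (at x) v + frechet_derivative f (at x) v * h x"
    if "x \<in> S" for x v
  proof -
    have "((\<lambda>x. f x * h x) has_derivative
        (\<lambda>v. f x * frechet_derivative h (at x) v + frechet_derivative f (at x) v * h x)) (at x)"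
      by (rule has_derivative_mult)
         (use Suc.prems that in \<open>auto simp flip: frechet_derivative_works\<close>)
    then show ?thesis
      by (simp flip: frechet_derivative_at)
  qed
  have Ck: "Ck_on k S (\<lambda>x. f x * frechet_derivative h (at x) v
      + frechet_derivative f (at x) v * h x)" for v
  proof (intro Ck_on_add[OF \<open>open S\<close>] Suc.IH)
    show "Ck_on k S f" "Ck_on k S h"
      using Suc.prems by (blast dest: Ck_on_SucD)+
    show "Ck_on k S (\<lambda>x. frechet_derivative f (at x) v)"
      "Ck_on k S (\<lambda>x. frechet_derivative h (at x) v)"
      using Suc.prems by auto
  qed
  have "Ck_on k S (\<lambda>x. frechet_derivative (\<lambda>x. f x * h x) (at x) v)" for v
    by (rule Ck_on_cong[OF \<open>open S\<close>, of k
          "\<lambda>x. f x * frechet_derivative h (at x) v + frechet_derivative f (at x) v * h x"])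
      (use Ck in blast, rule deriv[symmetric])
  moreover have "(\<lambda>x. f x * h x) differentiable (at x)" if "x \<in> S" for x
    by (rule differentiable_mult) (use Suc.prems that in simp_all)
  ultimately show ?case
    by simp
qed

lemma smooth_functions_const: "(\<lambda>_. c) \<in> smooth_functions A"
  by (auto simp: smooth_functions_def smooth_on_def o_def Ck_on_const)

lemma smooth_functions_add:
  assumes "smooth_atlas A" "f \<in> smooth_functions A" "h \<in> smooth_functions A"
  shows "f + h \<in> smooth_functions A"
  using assms unfolding smooth_functions_def smooth_on_def smooth_atlas_def
  by (fastforce simp: o_def intro: Ck_on_add)

lemma smooth_functions_mult:
  assumes "smooth_atlas A" "f \<in> smooth_functions A" "h \<in> smooth_functions A"
  shows "f * h \<in> smooth_functions A"
  using assms unfolding smooth_functions_def smooth_on_def smooth_atlas_def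
  by (fastforce simp: o_def intro: Ck_on_mult)

section \<open>Vector fields form a module over the smooth functions\<close>

lemma tangent_space_add:
  "u \<in> tangent_space A a \<Longrightarrow> v \<in> tangent_space A a \<Longrightarrow> u + v \<in> tangent_space A a"
  by (auto simp: tangent_space_def algebra_simps)

lemma tangent_space_tscale:
  "u \<in> tangent_space A a \<Longrightarrow> tscale c u \<in> tangent_space A a"
  by (auto simp: tangent_space_def tscale_def algebra_simps)

lemma vector_fields_tangent: "X \<in> vector_fields A \<Longrightarrow> X a \<in> tangent_space A a"
  by (simp add: vector_fields_def)

lemma vector_fields_add:
  assumes "smooth_atlas A" "X \<in> vector_fields A" "Y \<in> vector_fields A"
  shows "X + Y \<in> vector_fields A"
proof -
  have "deriv_along (X + Y) f = deriv_along X f + deriv_along Y f" for f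
    by (simp add: deriv_along_def fun_eq_iff)
  with assms show ?thesis
    by (auto simp: vector_fields_def tangent_space_add intro: smooth_functions_add)
qed

lemma vector_fields_fmul:
  assumes "smooth_atlas A" "f \<in> smooth_functions A" "X \<in> vector_fields A"
  shows "f \<odot> X \<in> vector_fields A"
proof -
  have "deriv_along (f \<odot> X) h = f * deriv_along X h" for h
    by (simp add: deriv_along_def fun_eq_iff fmul_def tscale_def)
  with assms show ?thesis
    by (auto simp: vector_fields_def fmul_def tangent_space_tscale intro: smooth_functions_mult)
qed

lemma vector_fields_cmul:
  assumes "smooth_atlas A" "X \<in> vector_fields A"
  shows "c \<odot>\<^sub>R X \<in> vector_fields A"
  using vector_fields_fmul[OF assms(1) smooth_functions_const assms(2), of c]
  by (simp add: fmul_def cmul_def)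

lemma vector_fields_diff:
  assumes "smooth_atlas A" "X \<in> vector_fields A" "Y \<in> vector_fields A"
  shows "X - Y \<in> vector_fields A"
proof -
  have "X - Y = X + (-1) \<odot>\<^sub>R Y"
    by (simp add: cmul_def tscale_def fun_eq_iff)
  with assms show ?thesis by (simp only: vector_fields_add vector_fields_cmul)
qed

lemma deriv_along_add:
  assumes "X \<in> vector_fields A" "f \<in> smooth_functions A" "h \<in> smooth_functions A"
  shows "deriv_along X (f + h) a = deriv_along X f a + deriv_along X h a"
  using assms by (auto simp: vector_fields_def tangent_space_def deriv_along_def)

lemma deriv_along_scale:
  assumes "X \<in> vector_fields A" "f \<in> smooth_functions A"
  shows "deriv_along X (\<lambda>b. c * f b) a = c * deriv_along X f a"
  using assms by (auto simp: vector_fields_def tangent_space_def deriv_along_def)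

lemma deriv_along_mult:
  assumes "X \<in> vector_fields A" "f \<in> smooth_functions A" "h \<in> smooth_functions A"
  shows "deriv_along X (f * h) a = deriv_along X f a * h a + f a * deriv_along X h a"
  using assms by (auto simp: vector_fields_def tangent_space_def deriv_along_def)

lemma smooth_functions_scale:
  assumes "smooth_atlas A" "f \<in> smooth_functions A"
  shows "(\<lambda>b. c * f b) \<in> smooth_functions A"
  using smooth_functions_mult[OF assms(1) smooth_functions_const assms(2), of c]
  by (simp add: times_fun_def)

lemma smooth_functions_diff:
  assumes "smooth_atlas A" "f \<in> smooth_functions A" "h \<in> smooth_functions A"
  shows "f - h \<in> smooth_functions A"
proof -
  have "f - h = f + (\<lambda>b. (-1) * h b)" by (simp add: fun_eq_iff)
  with assms show ?thesis by (simp only: smooth_functions_add smooth_functions_scale)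
qed

lemma deriv_along_diff:
  assumes "smooth_atlas A" "X \<in> vector_fields A" "f \<in> smooth_functions A" "h \<in> smooth_functions A"
  shows "deriv_along X (f - h) a = deriv_along X f a - deriv_along X h a"
  using deriv_along_add[OF assms(2) smooth_functions_diff[OF assms(1,3,4)] assms(4), of a]
  by simp

section \<open>Tensor calculus on a W1-manifold\<close>

locale natural_W1 =
  fixes A :: "('a::topological_space, 'm::finite) atlas"
    and n :: nat
    and g :: "'a metric_field" and P :: "'a endo_field" and D :: "'a conn"
    and \<Omega> :: "'a vfield" and lam mu :: real
  assumes W1: "W1_manifold A n g P D"
    and Omega_field: "\<Omega> \<in> vector_fields A"
    and met_Omega: "x \<in> vector_fields A \<Longrightarrow> met g \<Omega> x = theta A g P D x"
begin

abbreviation "\<X> \<equiv> vector_fields A"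
abbreviation "\<theta> \<equiv> theta A g P D"
abbreviation "D' \<equiv> natural_connection n g P D \<theta> \<Omega> lam mu"
definition "p = p_field n P \<Omega> lam mu"
definition "q = q_field P \<Omega> lam mu"
definition "c = 1 / (2 * real n)"

lemma atlas: "smooth_atlas A"
  using W1 by (simp add: W1_manifold_def riemannian_almost_product_def)

lemma metric: "riemannian_metric A g"
  using W1 by (simp add: W1_manifold_def riemannian_almost_product_def)

lemma P_field [simp]: "X \<in> \<X> \<Longrightarrow> app P X \<in> \<X>"
  using W1 by (simp add: W1_manifold_def riemannian_almost_product_def tensor_field_11_def)

lemma D_field [simp]: "X \<in> \<X> \<Longrightarrow> Y \<in> \<X> \<Longrightarrow> D X Y \<in> \<X>"
  using W1 smooth_functions_const[of 0 A]
  unfolding W1_manifold_def levi_civita_def linear_connection_def by blast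

lemma met_smooth [simp]: "X \<in> \<X> \<Longrightarrow> Y \<in> \<X> \<Longrightarrow> met g X Y \<in> smooth_functions A"
  using metric by (simp add: riemannian_metric_def)

lemmas field_closed [simp] =
  Omega_field vector_fields_add[OF atlas] vector_fields_diff[OF atlas]
  vector_fields_fmul[OF atlas] vector_fields_cmul[OF atlas]

lemma p_closed [simp]: "p \<in> \<X>" and q_closed [simp]: "q \<in> \<X>"
  by (simp_all add: p_def q_def p_field_def q_field_def)

lemma metric_at:
  assumes "X \<in> \<X>" "Y \<in> \<X>" "Z \<in> \<X>"
  shows "g a (X a + Y a) (Z a) = g a (X a) (Z a) + g a (Y a) (Z a)"
    and "g a (tscale r (X a)) (Z a) = r * g a (X a) (Z a)"
    and "g a (X a) (Y a) = g a (Y a) (X a)"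
    and "X a \<noteq> 0 \<Longrightarrow> g a (X a) (X a) > 0"
  using metric vector_fields_tangent[OF assms(1)] vector_fields_tangent[OF assms(2)]
    vector_fields_tangent[OF assms(3)]
  unfolding riemannian_metric_def by blast+

lemma met_sym: "X \<in> \<X> \<Longrightarrow> Y \<in> \<X> \<Longrightarrow> met g X Y = met g Y X"
  by (simp add: met_def fun_eq_iff metric_at(3))

lemma met_add [simp]:
  "X \<in> \<X> \<Longrightarrow> Y \<in> \<X> \<Longrightarrow> Z \<in> \<X> \<Longrightarrow> met g (X + Y) Z a = met g X Z a + met g Y Z a"
  by (simp add: met_def metric_at(1))

lemma met_fmul [simp]:
  "X \<in> \<X> \<Longrightarrow> Z \<in> \<X> \<Longrightarrow> met g (f \<odot> X) Z a = f a * met g X Z a"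
  by (simp add: met_def fmul_def metric_at(2)[of X Z])

lemma met_cmul [simp]:
  "X \<in> \<X> \<Longrightarrow> Z \<in> \<X> \<Longrightarrow> met g (r \<odot>\<^sub>R X) Z a = r * met g X Z a"
  by (simp add: met_def cmul_def metric_at(2)[of X Z])

lemma met_diff [simp]:
  assumes "X \<in> \<X>" "Y \<in> \<X>" "Z \<in> \<X>"
  shows "met g (X - Y) Z a = met g X Z a - met g Y Z a"
  using met_add[of "X - Y" Y Z a] assms by simp

lemma almost_product_at:
  "u \<in> tangent_space A a \<Longrightarrow> v \<in> tangent_space A a \<Longrightarrow>
    P a (P a u) = u \<and> g a (P a u) (P a v) = g a u v"
  using W1 unfolding W1_manifold_def riemannian_almost_product_def by blast

lemma met_add_right [simp]:
  "X \<in> \<X> \<Longrightarrow> Y \<in> \<X> \<Longrightarrow> Z \<in> \<X> \<Longrightarrow> met g X (Y + Z) a = met g X Y a + met g X Z a"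
  by (simp add: met_sym[of X])

lemma P_P [simp]: "X \<in> \<X> \<Longrightarrow> app P (app P X) = X"
  unfolding app_def
  by (rule ext, rule almost_product_at[THEN conjunct1]) (rule vector_fields_tangent, assumption)+

lemma met_P_P: "X \<in> \<X> \<Longrightarrow> Y \<in> \<X> \<Longrightarrow> met g (app P X) (app P Y) = met g X Y"
  by (simp only: app_def met_def almost_product_at vector_fields_tangent)

lemma met_P: "X \<in> \<X> \<Longrightarrow> Y \<in> \<X> \<Longrightarrow> met g (app P X) Y = met g X (app P Y)"
  using met_P_P[of X "app P Y"] by simp

text \<open>
  Positive definiteness, with the difference of the two fields, itself a vector field, as the
  test field \<open>Z\<close>.
\<close>

lemma met_eqI:
  assumes "X \<in> \<X>" "Y \<in> \<X>" "\<And>Z a. Z \<in> \<X> \<Longrightarrow> met g X Z a = met g Y Z a"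
  shows "X = Y"
proof
  fix a
  have XY: "X - Y \<in> \<X>"
    using assms by simp
  with assms have "met g (X - Y) (X - Y) a = 0"
    by (simp only: met_diff)
  with metric_at(4)[OF XY XY XY, of a] have "(X - Y) a = 0"
    unfolding met_def by fastforce
  then show "X a = Y a" by simp
qed

lemma D_add: "X \<in> \<X> \<Longrightarrow> Y \<in> \<X> \<Longrightarrow> Z \<in> \<X> \<Longrightarrow> D X (Y + Z) = D X Y + D X Z"
  using W1 smooth_functions_const[of 0 A]
  unfolding W1_manifold_def levi_civita_def linear_connection_def by blast

lemma D_torsion_free: "X \<in> \<X> \<Longrightarrow> Y \<in> \<X> \<Longrightarrow> D X Y - D Y X = lie_bracket X Y"
  using W1 unfolding W1_manifold_def levi_civita_def by blast

lemma D_metric: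
  "X \<in> \<X> \<Longrightarrow> Y \<in> \<X> \<Longrightarrow> Z \<in> \<X> \<Longrightarrow>
    deriv_along X (met g Y Z) = met g (D X Y) Z + met g Y (D X Z)"
  using W1 unfolding W1_manifold_def levi_civita_def by blast

lemma lie_bracket_field [simp]: "X \<in> \<X> \<Longrightarrow> Y \<in> \<X> \<Longrightarrow> lie_bracket X Y \<in> \<X>"
  by (simp flip: D_torsion_free)

lemma met_p: "X \<in> \<X> \<Longrightarrow> met g p X a = lam * \<theta> X a + (mu + c) * \<theta> (app P X) a"
  by (simp add: p_def p_field_def c_def met_P met_Omega)

lemma met_q: "X \<in> \<X> \<Longrightarrow> met g q X a = lam * \<theta> (app P X) a + mu * \<theta> X a"
  by (simp add: q_def q_field_def met_P met_Omega)

text \<open>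
  As relations between vector fields, the next two lemmas are \<open>P p = q + c \<Omega>\<close> and
  \<open>P q = p - c P \<Omega>\<close>.
\<close>

lemma met_p_P: "X \<in> \<X> \<Longrightarrow> met g p (app P X) a = met g q X a + c * \<theta> X a"
  by (simp add: met_p met_q algebra_simps)

lemma met_q_P: "X \<in> \<X> \<Longrightarrow> met g q (app P X) a = met g p X a - c * \<theta> (app P X) a"
  by (simp add: met_p met_q algebra_simps)

section \<open>The natural connection is metric and preserves the product structure\<close>

text \<open>The difference tensor \<open>D' - D\<close>.\<close>

definition Q :: "'a conn" where
  "Q x y = met g x (app P y) \<odot> q - met g q y \<odot> app P x + met g x y \<odot> p - met g p y \<odot> x"

lemma Q_field [simp]: "X \<in> \<X> \<Longrightarrow> Y \<in> \<X> \<Longrightarrow> Q X Y \<in> \<X>"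
  by (simp add: Q_def)

lemma natural_connection_eq: "X \<in> \<X> \<Longrightarrow> Y \<in> \<X> \<Longrightarrow> D' X Y = D X Y + Q X Y"
proof -
  assume XY: "X \<in> \<X>" "Y \<in> \<X>"
  have "met g p Y = (\<lambda>a. lam * \<theta> Y a + (mu + 1 / (2 * real n)) * \<theta> (app P Y) a)"
    "met g q Y = (\<lambda>a. lam * \<theta> (app P Y) a + mu * \<theta> Y a)"
    using XY by (auto simp: fun_eq_iff met_p met_q c_def)
  then show ?thesis
    by (simp add: natural_connection_def Q_def p_def q_def p_field_def q_field_def)
qed

lemma D'_field [simp]: "X \<in> \<X> \<Longrightarrow> Y \<in> \<X> \<Longrightarrow> D' X Y \<in> \<X>"
  by (simp add: natural_connection_eq)

lemma met_Q:
  "X \<in> \<X> \<Longrightarrow> Y \<in> \<X> \<Longrightarrow> W \<in> \<X> \<Longrightarrow> met g (Q X Y) W a =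
     met g X (app P Y) a * met g q W a - met g q Y a * met g X (app P W) a
   + met g X Y a * met g p W a - met g p Y a * met g X W a"
  by (simp add: Q_def met_P)

lemma Q_skew:
  "X \<in> \<X> \<Longrightarrow> Y \<in> \<X> \<Longrightarrow> W \<in> \<X> \<Longrightarrow> met g Y (Q X W) a = - met g (Q X Y) W a"
  by (simp add: met_sym[of Y] met_Q)

lemma met_Q_add_left:
  "X \<in> \<X> \<Longrightarrow> Y \<in> \<X> \<Longrightarrow> Z \<in> \<X> \<Longrightarrow> W \<in> \<X> \<Longrightarrow>
    met g (Q (X + Y) Z) W a = met g (Q X Z) W a + met g (Q Y Z) W a"
  by (simp add: met_Q algebra_simps)

text \<open>Skewness brings the sum into a slot of the metric, where it splits.\<close>

lemma met_Q_add_right: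
  assumes "X \<in> \<X>" "Y \<in> \<X>" "Z \<in> \<X>" "W \<in> \<X>"
  shows "met g (Q X (Y + Z)) W a = met g (Q X Y) W a + met g (Q X Z) W a"
proof -
  have "met g (Q X V) W a = - met g V (Q X W) a" if "V \<in> \<X>" for V
    using assms that by (simp add: Q_skew)
  with assms show ?thesis by simp
qed

lemma D'_metric:
  assumes "X \<in> \<X>" "Y \<in> \<X>" "Z \<in> \<X>"
  shows "deriv_along X (met g Y Z) a = met g (D' X Y) Z a + met g Y (D' X Z) a"
  using assms by (simp add: natural_connection_eq D_metric Q_skew)

text \<open>
  In \<open>Q x (P y) - P (Q x y)\<close> the fields \<open>p\<close> and \<open>q\<close> occur only as \<open>P p - q\<close> and \<open>p - P q\<close>, so
  \<open>lam\<close> and \<open>mu\<close> drop out and what remains is the negative of the W1 formula for \<open>(D_x P) y\<close>.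
  This is where the summand \<open>c\<close> next to \<open>mu\<close> in the connection comes from.
\<close>

lemma D'_parallel:
  assumes XY: "X \<in> \<X>" "Y \<in> \<X>"
  shows "D' X (app P Y) = app P (D' X Y)"
proof (rule met_eqI)
  fix Z a assume Z: "Z \<in> \<X>"
  have "F_tensor g P D X Y Z a = c * (met g X Y a * \<theta> Z a
      - met g X (app P Y) a * \<theta> (app P Z) a + met g X Z a * \<theta> Y a
      - met g X (app P Z) a * \<theta> (app P Y) a)"
    using W1 XY Z by (auto simp: W1_manifold_def c_def)
  then show "met g (D' X (app P Y)) Z a = met g (app P (D' X Y)) Z a"
    using XY Z
    by (simp add: F_tensor_def natural_connection_eq met_P met_Q met_p_P met_q_P algebra_simps)
qed (use XY in auto)

lemma theta_smooth [simp]: "X \<in> \<X> \<Longrightarrow> \<theta> X \<in> smooth_functions A"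
  by (simp flip: met_Omega)

section \<open>The covariant derivative of the difference tensor\<close>

abbreviation "U \<equiv> U_tensor n P D' \<theta> lam mu"
abbreviation "V \<equiv> V_tensor P D' \<theta> lam mu"

text \<open>
  Since \<open>D'\<close> is metric, this and the next lemma say \<open>g(D'_x p, w) = U(x,w)\<close> and
  \<open>g(D'_x q, w) = V(x,w)\<close>. They are kept in undifferentiated form for \<open>p\<close> and \<open>q\<close> because
  the Leibniz rule for \<open>Q\<close> produces derivatives of \<open>g(p, w)\<close> and \<open>g(q, w)\<close>.
\<close>

lemma deriv_along_p:
  assumes "X \<in> \<X>" "W \<in> \<X>"
  shows "deriv_along X (met g p W) a = U X W a + met g p (D' X W) a"
proof -
  have "met g p W = (\<lambda>b. lam * \<theta> W b) + (\<lambda>b. (mu + c) * \<theta> (app P W) b)"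
    using assms by (simp add: fun_eq_iff met_p)
  then show ?thesis
    using assms
    by (simp only: deriv_along_add smooth_functions_scale atlas deriv_along_scale U_tensor_def
        cov_form_def D'_parallel met_p theta_smooth P_field D'_field flip: c_def)
      (simp add: algebra_simps)
qed

lemma deriv_along_q:
  assumes "X \<in> \<X>" "W \<in> \<X>"
  shows "deriv_along X (met g q W) a = V X W a + met g q (D' X W) a"
proof -
  have "met g q W = (\<lambda>b. lam * \<theta> (app P W) b) + (\<lambda>b. mu * \<theta> W b)"
    using assms by (simp add: fun_eq_iff met_q)
  then show ?thesis
    using assms
    by (simp add: deriv_along_add smooth_functions_scale atlas deriv_along_scale V_tensor_def
        cov_form_def D'_parallel met_q algebra_simps)
qed

definition nabla_Q :: "'a vfield \<Rightarrow> 'a vfield \<Rightarrow> 'a vfield \<Rightarrow> 'a vfield" where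
  "nabla_Q X Y Z = D' X (Q Y Z) - Q (D' X Y) Z - Q Y (D' X Z)"

text \<open>
  The metric and \<open>P\<close> are parallel, so of the four products in \<open>Q\<close> only the derivatives of \<open>p\<close>
  and \<open>q\<close> survive; those of the arguments cancel against the correction terms.
\<close>

lemma met_nabla_Q:
  assumes X: "X \<in> \<X>" and Y: "Y \<in> \<X>" and Z: "Z \<in> \<X>" and W: "W \<in> \<X>"
  shows "met g (nabla_Q X Y Z) W a =
    met g Y (app P Z) a * V X W a - V X Z a * met g Y (app P W) a
    + met g Y Z a * U X W a - U X Z a * met g Y W a"
proof -
  note [simp] = X Y Z W
  have Q_eq: "met g (Q Y Z) W = met g Y (app P Z) * met g q W - met g q Z * met g Y (app P W)
      + met g Y Z * met g p W - met g p Z * met g Y W"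
    by (simp add: fun_eq_iff met_Q)
  have deriv_Q: "deriv_along X (met g (Q Y Z) W) a =
      (met g (D' X Y) (app P Z) a + met g Y (app P (D' X Z)) a) * met g q W a
    + met g Y (app P Z) a * (V X W a + met g q (D' X W) a)
    - ((V X Z a + met g q (D' X Z) a) * met g Y (app P W) a
    + met g q Z a * (met g (D' X Y) (app P W) a + met g Y (app P (D' X W)) a))
    + ((met g (D' X Y) Z a + met g Y (D' X Z) a) * met g p W a
    + met g Y Z a * (U X W a + met g p (D' X W) a))
    - ((U X Z a + met g p (D' X Z) a) * met g Y W a
    + met g p Z a * (met g (D' X Y) W a + met g Y (D' X W) a))"
    unfolding Q_eq
    by (simp add: deriv_along_add[OF X] deriv_along_diff[OF atlas X] deriv_along_mult[OF X]
        smooth_functions_add smooth_functions_diff smooth_functions_mult atlas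
        D'_metric[OF X Y] deriv_along_p deriv_along_q D'_parallel)
  have "met g (nabla_Q X Y Z) W a = deriv_along X (met g (Q Y Z) W) a
      - met g (Q Y Z) (D' X W) a - met g (Q (D' X Y) Z) W a - met g (Q Y (D' X Z)) W a"
    by (simp add: nabla_Q_def D'_metric[of X "Q Y Z" W])
  also have "\<dots> = met g Y (app P Z) a * V X W a - V X Z a * met g Y (app P W) a
    + met g Y Z a * U X W a - U X Z a * met g Y W a"
    unfolding deriv_Q by (simp add: met_Q D'_parallel algebra_simps)
  finally show ?thesis .
qed

section \<open>The difference of the curvatures\<close>

text \<open>
  Expand both curvatures with \<open>D' = D + Q\<close>. The terms with \<open>Q\<close> of \<open>D x y\<close>, \<open>D y x\<close> and the Lie
  bracket cancel since \<open>D\<close> is torsion free, leaving the torsion \<open>Q x y - Q y x\<close> of \<open>D'\<close>.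
\<close>

lemma curv4_difference:
  assumes X: "X \<in> \<X>" and Y: "Y \<in> \<X>" and Z: "Z \<in> \<X>" and W: "W \<in> \<X>"
  shows "curv4 g D X Y Z W a = curv4 g D' X Y Z W a
    - met g (nabla_Q X Y Z) W a + met g (nabla_Q Y X Z) W a
    - met g (Q (Q X Y) Z) W a + met g (Q (Q Y X) Z) W a
    + met g (Q X (Q Y Z)) W a - met g (Q Y (Q X Z)) W a"
proof -
  note [simp] = X Y Z W
  have "met g (Q (lie_bracket X Y) Z) W a = met g (Q (D X Y) Z) W a - met g (Q (D Y X) Z) W a"
    unfolding D_torsion_free[OF X Y, symmetric] by (simp add: met_Q algebra_simps)
  then show ?thesis
    by (simp add: curv4_def curv_def nabla_Q_def natural_connection_eq D_add
        met_Q_add_left met_Q_add_right)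
qed

text \<open>
  Skewness of \<open>Q X\<close> turns the first two terms into \<open>g(Q X Z, Q Y W) - g(Q Y Z, Q X W)\<close>, whose
  products of two of the fields \<open>p\<close>, \<open>q\<close> with each other are the \<open>\<pi>\<close> terms. Of the remaining
  products, those symmetric in \<open>X\<close> and \<open>Y\<close> cancel, and those in which \<open>p\<close> is paired with \<open>Z\<close> or
  \<open>W\<close> cancel against the torsion terms. What is left is, minus the same with \<open>X\<close> and \<open>Y\<close>
  exchanged, the sum of
  \<open>g(P p - q, Y) = c \<theta>(Y)\<close> times \<open>g(q,Z) g(X,W) - g(X,Z) g(q,W)\<close> and
  \<open>g(P q - p, Y) = - c \<theta>(P Y)\<close> times \<open>g(q,Z) g(P X,W) - g(P X,Z) g(q,W)\<close>.
\<close>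

lemma Q_quadratic_terms:
  assumes X: "X \<in> \<X>" and Y: "Y \<in> \<X>" and Z: "Z \<in> \<X>" and W: "W \<in> \<X>"
  shows "met g (Q X (Q Y Z)) W a - met g (Q Y (Q X Z)) W a
      - met g (Q (Q X Y) Z) W a + met g (Q (Q Y X) Z) W a =
    - met g p p a * pi1 g X Y Z W a - met g q q a * pi2 g P X Y Z W a
    - met g p q a * pi3 g P X Y Z W a
    + c * (psi1 g (\<lambda>y z b. \<theta> y b * met g q z b) X Y Z W a
         - psi2 g P (\<lambda>y z b. \<theta> (app P y) b * met g q (app P z) b) X Y Z W a)"
proof -
  note [simp] = X Y Z W
  (* The next rewrite rules bring every scalar product into one normal form: Q to the left,
     then p and q to the left, and P onto the argument of p or q or onto the right factor. *)
  have p_right: "met g X' p = met g p X'" "met g X' (app P p) = met g p (app P X')"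
    and q_right: "met g X' q = met g q X'" "met g X' (app P q) = met g q (app P X')"
    if "X' \<in> {X, Y, Z, W}" for X'
    using that by (auto simp: met_sym met_P)
  have Q_right: "met g X' (Q Y' Z') = met g (Q Y' Z') X'"
    "met g X' (app P (Q Y' Z')) = met g (Q Y' Z') (app P X')"
    if "X' \<in> \<X>" "Y' \<in> \<X>" "Z' \<in> \<X>" for X' Y' Z'
    using that by (simp_all add: met_sym[of X'] met_P)
  have YX: "met g Y X = met g X Y" "met g Y (app P X) = met g X (app P Y)"
    by (simp_all add: met_sym[of Y] met_P)
  show ?thesis
    by (simp add: Q_right p_right q_right YX met_sym[of q p] met_p_P met_q_P met_Q met_P
        pi1_def pi2_def pi3_def psi1_def psi2_def assoc_metric_def) algebra
qed

end

theorem theorem3p1: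
  fixes A :: "('a::{t2_space, second_countable_topology}, 'm::finite) atlas"
    and n :: nat
    and g :: "'a metric_field" and P :: "'a endo_field" and D :: "'a conn"
    and \<Omega> :: "'a vfield" and lam mu :: real
  assumes "W1_manifold A n g P D"
    and "\<Omega> \<in> vector_fields A"
    and "\<forall>x\<in>vector_fields A. met g \<Omega> x = theta A g P D x"
  shows "let \<theta> = theta A g P D;
             D' = natural_connection n g P D \<theta> \<Omega> lam mu;
             p = p_field n P \<Omega> lam mu;
             q = q_field P \<Omega> lam mu;
             S' = S1_tensor n P D' \<theta> lam mu;
             S'' = S2_tensor n P D' \<theta> lam mu
         in \<forall>x\<in>vector_fields A. \<forall>y\<in>vector_fields A. \<forall>z\<in>vector_fields A. \<forall>w\<in>vector_fields A.
              curv4 g D x y z w =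
                curv4 g D' x y z w - met g p p * pi1 g x y z w - met g q q * pi2 g P x y z w
                - met g p q * pi3 g P x y z w - psi1 g S' x y z w - psi2 g P S'' x y z w"
proof -
  interpret natural_W1 A n g P D \<Omega> lam mu
    using assms by unfold_locales auto
  have S1: "S1_tensor n P D' \<theta> lam mu y z a = U y z a - c * (\<theta> y a * met g q z a)"
    if "y \<in> \<X>" "z \<in> \<X>" for y z a
    using that by (simp add: S1_tensor_def met_q c_def algebra_simps)
  (* psi2 evaluates S'' only with P in the second slot, where P (P z) = z simplifies it. *)
  have S2: "S2_tensor n P D' \<theta> lam mu y (app P z) a = V y z a + c * (\<theta> (app P y) a * met g q z a)"
    if "y \<in> \<X>" "z \<in> \<X>" for y z a
    using that by (simp add: S2_tensor_def met_q c_def algebra_simps)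
  have "curv4 g D x y z w a =
      (curv4 g D' x y z w - met g p p * pi1 g x y z w - met g q q * pi2 g P x y z w
       - met g p q * pi3 g P x y z w - psi1 g (S1_tensor n P D' \<theta> lam mu) x y z w
       - psi2 g P (S2_tensor n P D' \<theta> lam mu) x y z w) a"
    if [simp]: "x \<in> \<X>" "y \<in> \<X>" "z \<in> \<X>" "w \<in> \<X>" for x y z w a
    using curv4_difference[of x y z w a] Q_quadratic_terms[of x y z w a]
    by (simp add: met_nabla_Q psi1_def psi2_def S1 S2 algebra_simps)
  then show ?thesis
    unfolding Let_def by (auto simp: fun_eq_iff p_def q_def)
qed

end
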